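(* Let $n\ge2$ and $N\ge1$ be integers, $p_1,\dots,p_n>0$ real with $\sum_i p_i=1$, and let $m$ be any mode of the multinomial distribution with parameters $N$ and $(p_1,\dots,p_n)$. Then $\lfloor Np_i\rfloor\le m_i$ for every $i$, and $$m_i-\lceil Np_i\rceil\ \le\ n-2\qquad(1\le i\le n).$$ The bound $n-2$ is attained: for every $n\ge2$ there exist $N$, $(p_1,\dots,p_n)$, a mode $m$ and an index $i$ with $m_i-\lceil Np_i\rceil=n-2$. Moreover, a coordinate can satisfy $m_i>\lceil Np_i\rceil$ only if $$n\,p_i>1+h_i,\qquad h_i:=\lceil Np_i\rceil-Np_i,$$ and in particular only if $p_i>1/n$.
   Context: A mode is a maximiser of $P(m)=\frac{N!}{m_1!\cdots m_n!}\prod_i p_i^{m_i}$ over $m\in\mathbb Z_{\ge0}^n$ with $\sum_i m_i=N$. *)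

theory Defs
  imports Complex_Main
begin

text \<open>Vectors indexed by \<open>1, \<dots>, n\<close> are functions on \<^typ>\<open>nat\<close>; only their values on
  \<open>{1..n}\<close> matter.\<close>

definition is_prob_vector :: "nat \<Rightarrow> (nat \<Rightarrow> real) \<Rightarrow> bool" where
  "is_prob_vector n p \<longleftrightarrow> (\<forall>i\<in>{1..n}. p i > 0) \<and> (\<Sum>i=1..n. p i) = 1"

definition multinomial_prob :: "nat \<Rightarrow> nat \<Rightarrow> (nat \<Rightarrow> real) \<Rightarrow> (nat \<Rightarrow> nat) \<Rightarrow> real" where
  "multinomial_prob n N p m =
     fact N / (\<Prod>i=1..n. fact (m i)) * (\<Prod>i=1..n. p i ^ m i)"

definition is_multinomial_mode :: "nat \<Rightarrow> nat \<Rightarrow> (nat \<Rightarrow> real) \<Rightarrow> (nat \<Rightarrow> nat) \<Rightarrow> bool" where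
  "is_multinomial_mode n N p m \<longleftrightarrow>
     (\<Sum>i=1..n. m i) = N \<and>
     (\<forall>m'. (\<Sum>i=1..n. m' i) = N \<longrightarrow> multinomial_prob n N p m' \<le> multinomial_prob n N p m)"

end

theory Submission
  imports Defs
begin

text \<open>Moving one trial from coordinate \<open>i\<close> to coordinate \<open>j\<close> cannot increase the probability of a
  mode, which gives \<open>m\<^sub>i p\<^sub>j \<le> p\<^sub>i (m\<^sub>j + 1)\<close>. Summing this over \<open>j\<close>, respectively over \<open>i\<close>, yields
  \<open>m\<^sub>i \<le> p\<^sub>i (N + n - 1)\<close> and \<open>p\<^sub>i (N + 1) \<le> m\<^sub>i + 1\<close>, and all inequalities follow by rounding.
  For sharpness all trials fall on one coordinate: the other \<open>n - 1\<close> coordinates each carry an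
  expectation \<open>(n - 1) / n\<close>, which is just too small to force a trial there.\<close>

lemma multinomial_prob_eq_prod:
  "multinomial_prob n N p m = fact N * (\<Prod>i=1..n. p i ^ m i / fact (m i))"
  by (simp add: multinomial_prob_def prod_dividef)

text \<open>The neighbour of \<open>m\<close> with one trial moved from \<open>i\<close> to
  \<open>j\<close> has \<open>m i * p j / (p i * (m j + 1))\<close> times its probability, so
  maximality bounds this ratio by 1. The cross-multiplied form also covers \<open>m i = 0\<close>,
  where there is no trial to move.\<close>

lemma multinomial_mode_exchange:
  assumes p: "is_prob_vector n p" and mode: "is_multinomial_mode n N p m"
    and i: "i \<in> {1..n}" and j: "j \<in> {1..n}"
  shows "real (m i) * p j \<le> p i * (real (m j) + 1)"
proof (cases "i = j \<or> m i = 0")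
  case True
  moreover have "p i > 0"
    using p i by (simp add: is_prob_vector_def)
  ultimately show ?thesis
    by (auto simp: distrib_left)
next
  case False
  then obtain a where ij: "i \<noteq> j" and a: "m i = Suc a"
    by (cases "m i") auto
  define b where "b = m j"
  define m' where "m' = m(i := a, j := Suc b)"
  define R where "R = {1..n} - {i} - {j}"
  have fin: "finite R" and iR: "i \<notin> insert j R" and jR: "j \<notin> R"
    and split: "{1..n} = insert i (insert j R)"
    using i j ij by (auto simp: R_def)
  have off: "m' k = m k" if "k \<in> R" for k
    using that by (auto simp: m'_def R_def)
  have "sum m' {1..n} = sum m {1..n}"
  proof -
    have "sum m' R = sum m R"
      by (intro sum.cong) (simp_all add: off)
    then show ?thesis
      unfolding split using fin iR jR ij a by (simp add: m'_def b_def)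
  qed
  with mode have le: "multinomial_prob n N p m' \<le> multinomial_prob n N p m"
    by (simp add: is_multinomial_mode_def)
  define w where "w k c = p k ^ c / fact c" for k c
  \<comment> \<open>\<open>W\<close> collects the factors of the untouched coordinates; being
    positive, it cancels from the comparison of \<open>m'\<close> with \<open>m\<close>.\<close>
  define W where "W = (\<Prod>k\<in>R. w k (m k))"
  have pos: "p k > 0" if "k \<in> {1..n}" for k
    using p that by (simp add: is_prob_vector_def)
  have "W > 0"
    unfolding W_def w_def using pos by (intro prod_pos) (simp add: R_def)
  have "multinomial_prob n N p m = fact N * (w i (Suc a) * (w j b * W))"
    unfolding multinomial_prob_eq_prod split w_def[symmetric] W_def
    using fin iR jR a by (simp add: b_def)
  moreover have "multinomial_prob n N p m' = fact N * (w i a * (w j (Suc b) * W))"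
  proof -
    have "(\<Prod>k\<in>R. w k (m' k)) = W"
      unfolding W_def by (intro prod.cong) (simp_all add: off)
    then show ?thesis
      unfolding multinomial_prob_eq_prod split w_def[symmetric]
      using fin iR jR ij by (simp add: m'_def)
  qed
  ultimately have "w i a * w j (Suc b) \<le> w i (Suc a) * w j b"
    using le \<open>W > 0\<close> by (simp add: mult.assoc[symmetric])
  moreover have "w k (Suc c) = w k c * (p k / real (Suc c))" for k c
    by (simp add: w_def field_simps)
  ultimately have "(w i a * w j b) * (p j / real (Suc b)) \<le> (w i a * w j b) * (p i / real (Suc a))"
    by (simp only: mult_ac)
  moreover have "w i a * w j b > 0"
    using pos i j by (simp add: w_def)
  ultimately have "p j / real (Suc b) \<le> p i / real (Suc a)"
    by (simp only: mult_le_cancel_left_pos)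
  then show ?thesis
    by (simp add: a b_def field_simps)
qed

text \<open>The exchange inequality has slack \<open>p i\<close> at \<open>j = i\<close>, so the sum
  runs over the other indices only. Including \<open>i\<close> would give \<open>N + n\<close> in
  place of \<open>N + n - 1\<close>, and in the end only the excess bound
  \<open>n - 1\<close>.\<close>

lemma multinomial_mode_upper:
  assumes "is_prob_vector n p" and "is_multinomial_mode n N p m" and i: "i \<in> {1..n}"
  shows "real (m i) \<le> p i * (real N + real n - 1)"
proof -
  have sums: "(\<Sum>j=1..n. p j) = 1" "(\<Sum>j=1..n. real (m j)) = real N"
    using assms by (simp_all add: is_prob_vector_def is_multinomial_mode_def flip: of_nat_sum)
  have "(\<Sum>j\<in>{1..n}-{i}. real (m i) * p j) \<le> (\<Sum>j\<in>{1..n}-{i}. p i * (real (m j) + 1))"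
    using assms by (intro sum_mono multinomial_mode_exchange) auto
  also have "\<dots> = p i * (real N - real (m i) + (real n - 1))"
    using i sums by (simp add: sum_distrib_left[symmetric] sum.distrib sum_diff1 of_nat_diff)
  also have "(\<Sum>j\<in>{1..n}-{i}. real (m i) * p j) = real (m i) * (1 - p i)"
    using i sums by (simp add: sum_distrib_left[symmetric] sum_diff1)
  finally show ?thesis
    by (simp add: algebra_simps)
qed

text \<open>Here \<open>i\<close> receives the trial. Leaving out \<open>j = i\<close> again gains a
  term \<open>p i\<close>, which makes \<open>N * p i < m i + 1\<close> strict, as rounding down
  requires.\<close>

lemma multinomial_mode_lower:
  assumes "is_prob_vector n p" and "is_multinomial_mode n N p m" and i: "i \<in> {1..n}"
  shows "p i * (real N + 1) \<le> real (m i) + 1"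
proof -
  have sums: "(\<Sum>j=1..n. p j) = 1" "(\<Sum>j=1..n. real (m j)) = real N"
    using assms by (simp_all add: is_prob_vector_def is_multinomial_mode_def flip: of_nat_sum)
  have "(\<Sum>j\<in>{1..n}-{i}. real (m j) * p i) \<le> (\<Sum>j\<in>{1..n}-{i}. p j * (real (m i) + 1))"
    using assms by (intro sum_mono multinomial_mode_exchange) auto
  also have "\<dots> = (1 - p i) * (real (m i) + 1)"
    using i sums by (simp add: sum_distrib_right[symmetric] sum_diff1)
  also have "(\<Sum>j\<in>{1..n}-{i}. real (m j) * p i) = (real N - real (m i)) * p i"
    using i sums by (simp add: sum_distrib_right[symmetric] sum_diff1)
  finally show ?thesis
    by (simp add: algebra_simps)
qed

lemma prob_vector_less_1:
  assumes "is_prob_vector n p" and "n \<ge> 2" and i: "i \<in> {1..n}"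
  shows "p i < 1"
proof -
  have "{1..n} - {i} \<noteq> {}"
  proof -
    have "(if i = 1 then 2 else 1) \<in> {1..n} - {i}"
      using assms by auto
    then show ?thesis by blast
  qed
  then have "(\<Sum>j\<in>{1..n}-{i}. p j) > 0"
    using assms by (intro sum_pos) (auto simp: is_prob_vector_def)
  then show ?thesis
    using assms by (simp add: sum_diff1 is_prob_vector_def)
qed

text \<open>Taking \<open>k\<close> trials off coordinate 1 raises the multinomial coefficient to at
  most \<open>N ^ k\<close> and trades \<open>q ^ k\<close> for \<open>\<epsilon> ^ k\<close>, so
  \<open>N * \<epsilon> \<le> q\<close> rules out any gain.\<close>

lemma concentrated_multinomial_mode:
  assumes n: "n \<ge> 1" and pos: "\<epsilon> > 0" and p1: "p 1 = q" and p: "\<And>i. i \<in> {2..n} \<Longrightarrow> p i = \<epsilon>"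
    and le: "real N * \<epsilon> \<le> q"
  shows "is_multinomial_mode n N p (\<lambda>i. if i = 1 then N else 0)"
    (is "is_multinomial_mode n N p ?m")
  unfolding is_multinomial_mode_def
proof (intro conjI allI impI)
  have split: "{1..n} = insert 1 {2..n}"
    using n by auto
  then show "(\<Sum>i=1..n. ?m i) = N"
    by simp
  fix m' :: "nat \<Rightarrow> nat"
  assume sum: "(\<Sum>i=1..n. m' i) = N"
  define k where "k = (\<Sum>i=2..n. m' i)"
  have N: "N = m' 1 + k"
    using sum unfolding split k_def by simp
  have "0 \<le> real N * \<epsilon>"
    using pos by simp
  with le have q: "q \<ge> 0"
    by linarith
  have "multinomial_prob n N p ?m = q ^ N"
    unfolding multinomial_prob_eq_prod split by (simp add: p1[simplified])
  moreover have "multinomial_prob n N p m' \<le> q ^ N"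
  proof -
    have "(\<Prod>i=2..n. p i ^ m' i / fact (m' i)) \<le> (\<Prod>i=2..n. \<epsilon> ^ m' i)"
      using pos by (intro prod_mono) (auto simp: p field_simps fact_ge_1 mult_le_cancel_left1)
    also have "\<dots> = \<epsilon> ^ k"
      by (simp add: power_sum k_def)
    finally have rest: "(\<Prod>i=2..n. p i ^ m' i / fact (m' i)) \<le> \<epsilon> ^ k" .
    \<comment> \<open>The quotient is a falling factorial with \<open>k\<close> factors, each at
      most \<open>N\<close>; the division is exact.\<close>
    have "real (fact N div fact (N - k)) \<le> real (N ^ k)"
      using fact_div_fact_le_pow[of k N] N by (subst of_nat_le_iff) simp
    moreover have "real (fact N div fact (N - k)) = fact N / fact (m' 1)"
      using N by (simp add: real_of_nat_div fact_dvd)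
    ultimately have fact: "fact N / fact (m' 1) \<le> real N ^ k"
      by simp
    have "multinomial_prob n N p m' =
        fact N / fact (m' 1) * q ^ m' 1 * (\<Prod>i=2..n. p i ^ m' i / fact (m' i))"
      unfolding multinomial_prob_eq_prod split by (simp add: p1[simplified])
    also have "\<dots> \<le> real N ^ k * q ^ m' 1 * \<epsilon> ^ k"
      using fact rest q pos by (intro mult_mono prod_nonneg) (auto simp: p)
    also have "\<dots> = (real N * \<epsilon>) ^ k * q ^ m' 1"
      by (simp add: power_mult_distrib mult_ac)
    also have "\<dots> \<le> q ^ k * q ^ m' 1"
      using le q pos by (intro mult_right_mono power_mono) auto
    also have "\<dots> = q ^ N"
      by (simp add: N power_add)
    finally show ?thesis .
  qed
  ultimately show "multinomial_prob n N p m' \<le> multinomial_prob n N p ?m"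
    by simp
qed

lemma multinomial_mode_excess_attained:
  assumes n: "n \<ge> 2"
  shows "\<exists>N p m. \<exists>i\<in>{1..n}. N \<ge> 1 \<and> is_prob_vector n p \<and> is_multinomial_mode n N p m \<and>
           int (m i) - \<lceil>real N * p i\<rceil> = int n - 2"
proof -
  define x where "x = real n"
  have x: "x \<ge> 2"
    using n by (simp add: x_def)
  \<comment> \<open>These values give \<open>N * \<epsilon> = 1 - 1/n\<close>. The small coordinates
    together take \<open>(n - 1) * (1 - 1/n) = n - 2 + 1/n\<close> from the expectation of
    coordinate 1, whose ceiling is then \<open>N - (n - 2)\<close>. Taking \<open>N\<close> as large
    as the square of \<open>n\<close> keeps \<open>(n - 1) * \<epsilon>\<close> below
    \<open>1/n\<close>, hence \<open>q\<close> above \<open>N * \<epsilon>\<close>.\<close>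
  define N where "N = n\<^sup>2"
  define \<epsilon> where "\<epsilon> = (x - 1) / x ^ 3"
  define q where "q = 1 - (x - 1) * \<epsilon>"
  define p where "p i = (if i = 1 then q else \<epsilon>)" for i :: nat
  define m where "m i = (if i = 1 then N else 0)" for i :: nat
  have N: "real N = x\<^sup>2"
    by (simp add: N_def x_def)
  have pos: "\<epsilon> > 0"
    using x by (simp add: \<epsilon>_def)
  have N\<epsilon>: "real N * \<epsilon> = 1 - 1 / x"
    using x by (simp add: N \<epsilon>_def field_simps power2_eq_square power3_eq_cube)
  have "(x - 1) * \<epsilon> \<le> 1 / x"
  proof -
    have "(x - 1) * (x - 1) \<le> x * x"
      using x by (intro mult_mono) auto
    then show ?thesis
      using x by (simp add: \<epsilon>_def field_simps power3_eq_cube)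
  qed
  then have le: "real N * \<epsilon> \<le> q"
    by (simp add: N\<epsilon> q_def)
  have "1 / x < 1"
    using x by simp
  then have q: "q > 0"
    using le N\<epsilon> by linarith
  have split: "{1..n} = insert 1 {2..n}"
    using n by auto
  have "(\<Sum>i=1..n. p i) = q + (\<Sum>i=2..n. \<epsilon>)"
    unfolding split by (simp add: p_def)
  also have "\<dots> = 1"
    using n by (simp add: q_def x_def of_nat_diff)
  finally have "is_prob_vector n p"
    using pos q by (simp add: is_prob_vector_def p_def)
  moreover have "is_multinomial_mode n N p m"
    unfolding m_def
    by (rule concentrated_multinomial_mode[OF _ pos _ _ le]) (use n in \<open>auto simp: p_def\<close>)
  moreover have "\<lceil>real N * p 1\<rceil> = int N - int n + 2"
  proof -
    have "real N * p 1 = real N - (x - 1) * (real N * \<epsilon>)"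
      by (simp add: p_def q_def algebra_simps)
    also have "\<dots> = real N - x + 2 - 1 / x"
      unfolding N\<epsilon> using x by (simp add: field_simps)
    finally show ?thesis
      using x \<open>1 / x < 1\<close> by (intro ceiling_unique) (simp_all add: x_def)
  qed
  moreover have "N \<ge> 1" "1 \<in> {1..n}"
    using n by (simp_all add: N_def)
  ultimately show ?thesis
    by (intro exI[of _ N] exI[of _ p] exI[of _ m] bexI[of _ 1]) (simp_all add: m_def)
qed

theorem proposition3p10:
  shows "(\<forall>(n::nat) (N::nat) (p::nat \<Rightarrow> real) (m::nat \<Rightarrow> nat).
            n \<ge> 2 \<and> N \<ge> 1 \<and> is_prob_vector n p \<and> is_multinomial_mode n N p m \<longrightarrow>
            (\<forall>i\<in>{1..n}.
               \<lfloor>real N * p i\<rfloor> \<le> int (m i) \<and>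
               int (m i) - \<lceil>real N * p i\<rceil> \<le> int n - 2 \<and>
               (int (m i) > \<lceil>real N * p i\<rceil> \<longrightarrow>
                  real n * p i > 1 + (real_of_int \<lceil>real N * p i\<rceil> - real N * p i) \<and>
                  p i > 1 / real n)))
       \<and> (\<forall>n::nat. n \<ge> 2 \<longrightarrow>
            (\<exists>(N::nat) (p::nat \<Rightarrow> real) (m::nat \<Rightarrow> nat). \<exists>i\<in>{1..n}.
               N \<ge> 1 \<and> is_prob_vector n p \<and> is_multinomial_mode n N p m \<and>
               int (m i) - \<lceil>real N * p i\<rceil> = int n - 2))"
proof (intro conjI allI impI ballI; (elim conjE)?)
  fix n N :: nat and p :: "nat \<Rightarrow> real" and m :: "nat \<Rightarrow> nat" and i :: nat
  assume n: "n \<ge> 2" and p: "is_prob_vector n p" and mode: "is_multinomial_mode n N p m"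
    and i: "i \<in> {1..n}"
  have pos: "p i > 0"
    using p i by (simp add: is_prob_vector_def)
  have upper: "real (m i) \<le> real N * p i + (real n - 1) * p i"
    using multinomial_mode_upper[OF p mode i] by (simp add: algebra_simps)
  have "real N * p i < real (m i) + 1"
    using multinomial_mode_lower[OF p mode i] pos by (simp add: algebra_simps)
  then show "\<lfloor>real N * p i\<rfloor> \<le> int (m i)"
    by linarith
  \<comment> \<open>Strictness comes from \<open>p i < 1\<close>; an integer excess below
    \<open>n - 1\<close> is at most \<open>n - 2\<close>.\<close>
  have "(real n - 1) * p i < real n - 1"
    using prob_vector_less_1[OF p n i] n by simp
  then have "real (m i) < real_of_int \<lceil>real N * p i\<rceil> + real n - 1"
    using upper le_of_int_ceiling[of "real N * p i"] by argo
  then show "int (m i) - \<lceil>real N * p i\<rceil> \<le> int n - 2"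
    by linarith
  assume "int (m i) > \<lceil>real N * p i\<rceil>"
  \<comment> \<open>By integrality the excess is at least 1, so \<open>upper\<close> yields
    \<open>1 + h \<le> (n - 1) * p i < n * p i\<close>, where \<open>h\<close> is the gap between
    \<open>N * p i\<close> and its ceiling.\<close>
  then have "real_of_int \<lceil>real N * p i\<rceil> + 1 \<le> real (m i)"
    by linarith
  then show "real n * p i > 1 + (real_of_int \<lceil>real N * p i\<rceil> - real N * p i)"
    using upper pos by (simp add: algebra_simps)
  then have "real n * p i > 1"
    by linarith
  then show "p i > 1 / real n"
    using n by (simp add: field_simps)
qed (rule multinomial_mode_excess_attained)

end
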